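(* Let $\mathcal{A}$ and $\mathcal{B}$ be structures that are enumerably bi-transformable. Then $\mathcal{A}$ and $\mathcal{B}$ are computably bi-transformable.
   Context: **Structures.** Structures are in computable relational languages, have countable universe, and are identified with their atomic diagrams: the set of (Gödel numbers, under a fixed Gödel numbering, of) atomic sentences and negated atomic sentences, with names for the elements of the universe and including equalities $b=b$ for $b$ in the universe, that are true in the structure. $\mathrm{Iso}(\mathcal{A})$ is the category whose objects are all structures with universe $\omega$ isomorphic to $\mathcal{A}$ and whose arrows are all isomorphisms between them. **Enumerable and computable functors.** An enumeration operator is a c.e. set $\Psi$ of pairs $(\alpha,b)$ with $\alpha\subseteq\omega$ finite and $b\in\omega$; $\Psi^X=\{b:(\exists\alpha\subseteq X)\,(\alpha,b)\in\Psi\}$ for $X\subseteq\omega$. A functor $F:\mathfrak{C}\to\mathfrak{D}$ between categories of structures (with isomorphisms as arrows) is enumerable if there are an enumeration operator $\Psi$ and a Turing operator $\Phi_*$ with $\Psi^{\mathcal{C}}=F(\mathcal{C})$ for every object $\mathcal{C}$ of $\mathfrak{C}$ and $\Phi_*^{\mathcal{C}\oplus f\oplus\mathcal{D}}=F(f)$ for every arrow $f:\mathcal{C}\to\mathcal{D}$ of $\mathfrak{C}$. It is computable if the same holds with $\Psi$ replaced by a Turing operator $\Phi$, i.e. $\Phi^{\mathcal{C}}=F(\mathcal{C})$ for every object $\mathcal{C}$. **Effectively isomorphic.** Functors $F,G:\mathfrak{C}\to\mathfrak{D}$ are effectively isomorphic if there is a Turing functional $\Lambda$ such that for every object $\mathcal{C}$,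 $\Lambda^{\mathcal{C}}$ is an isomorphism from $F(\mathcal{C})$ to $G(\mathcal{C})$, and $\Lambda^{\mathcal{D}}\circ F(h)=G(h)\circ\Lambda^{\mathcal{C}}$ for every arrow $h:\mathcal{C}\to\mathcal{D}$. **Pseudo-inverses.** Functors $F:\mathfrak{C}\to\mathfrak{D}$ and $G:\mathfrak{D}\to\mathfrak{C}$ are pseudo-inverses if $G\circ F$ and $F\circ G$ are effectively isomorphic to $\mathrm{id}_{\mathfrak{C}}$ and $\mathrm{id}_{\mathfrak{D}}$ via Turing functionals $\Lambda_{\mathfrak{C}}$ and $\Lambda_{\mathfrak{D}}$ (so $\Lambda_{\mathfrak{C}}^{\mathcal{C}}:\mathcal{C}\to G(F(\mathcal{C}))$ and $\Lambda_{\mathfrak{D}}^{\mathcal{D}}:\mathcal{D}\to F(G(\mathcal{D}))$) such that $\Lambda_{\mathfrak{D}}^{F(\mathcal{C})}=F(\Lambda_{\mathfrak{C}}^{\mathcal{C}})$ for all $\mathcal{C}\in\mathfrak{C}$ and $\Lambda_{\mathfrak{C}}^{G(\mathcal{D})}=G(\Lambda_{\mathfrak{D}}^{\mathcal{D}})$ for all $\mathcal{D}\in\mathfrak{D}$. **Bi-transformability.** $\mathcal{A}$ and $\mathcal{B}$ are enumerably (respectively computably) bi-transformable if there are enumerable (respectively computable) functors $F:\mathrm{Iso}(\mathcal{A})\to\mathrm{Iso}(\mathcal{B})$ and $G:\mathrm{Iso}(\mathcal{B})\to\mathrm{Iso}(\mathcal{A})$ which are pseudo-inverses. *)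

theory Defs
  imports "HOL-Library.Nat_Bijection" "HOL-Library.Countable_Set"
begin

text \<open>
  Codes for the partial recursive functions with a set oracle.  All functions are unary;
  several arguments are passed through the pairing bijection \<^const>\<open>prod_encode\<close>
  (so the identity is \<open>PPair PFst PSnd\<close>).  The same code is run with every oracle, so a code
  is a Turing operator, uniform in the oracle.
\<close>

datatype prog =
    PZero | PSucc | PFst | PSnd | POracle
  | PPair prog prog
  | PComp prog prog
  | PRec prog prog
  | PMu prog

primrec run :: "prog \<Rightarrow> nat set \<Rightarrow> nat \<Rightarrow> nat option" where
  "run PZero X n = Some 0"
| "run PSucc X n = Some (Suc n)"
| "run PFst X n = Some (fst (prod_decode n))"
| "run PSnd X n = Some (snd (prod_decode n))"
| "run POracle X n = Some (of_bool (n \<in> X))"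
| "run (PPair p q) X n =
     Option.bind (run p X n) (\<lambda>x. Option.bind (run q X n) (\<lambda>y. Some (prod_encode (x, y))))"
| "run (PComp p q) X n = Option.bind (run q X n) (run p X)"
| "run (PRec p q) X n =
     (case prod_decode n of (a, m) \<Rightarrow>
        rec_nat (run p X a)
          (\<lambda>i r. Option.bind r (\<lambda>z. run q X (prod_encode (a, prod_encode (i, z))))) m)"
| "run (PMu p) X a =
     (if \<exists>n. run p X (prod_encode (a, n)) = Some 0 \<and>
             (\<forall>m<n. \<exists>k. run p X (prod_encode (a, m)) = Some (Suc k))
      then Some (LEAST n. run p X (prod_encode (a, n)) = Some 0)
      else None)"

text \<open>\<open>computes_fun \<Phi> X f\<close> is \<open>\<Phi>\<^sup>X = f\<close> for a total \<open>f\<close>, and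
  \<open>computes_set \<Phi> X Y\<close> is \<open>\<Phi>\<^sup>X = Y\<close>, with \<open>Y\<close> given by its characteristic function.\<close>

definition computes_fun :: "prog \<Rightarrow> nat set \<Rightarrow> (nat \<Rightarrow> nat) \<Rightarrow> bool" where
  "computes_fun \<Phi> X f \<longleftrightarrow> (\<forall>n. run \<Phi> X n = Some (f n))"

definition computes_set :: "prog \<Rightarrow> nat set \<Rightarrow> nat set \<Rightarrow> bool" where
  "computes_set \<Phi> X Y \<longleftrightarrow> computes_fun \<Phi> X (\<lambda>n. of_bool (n \<in> Y))"

text \<open>The function \<open>\<Phi>\<^sup>X\<close>; only meaningful if it is total.\<close>

definition fun_of :: "prog \<Rightarrow> nat set \<Rightarrow> nat \<Rightarrow> nat" where
  "fun_of \<Phi> X n = the (run \<Phi> X n)"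

definition is_total :: "prog \<Rightarrow> nat set \<Rightarrow> bool" where
  "is_total \<Phi> X \<longleftrightarrow> (\<forall>n. run \<Phi> X n \<noteq> None)"

definition computable_set :: "nat set \<Rightarrow> bool" where
  "computable_set Y \<longleftrightarrow> (\<exists>p. computes_set p {} Y)"

definition ce_set :: "nat set \<Rightarrow> bool" where
  "ce_set Y \<longleftrightarrow> (\<exists>p. Y = {n. run p {} n \<noteq> None})"

definition join :: "nat set \<Rightarrow> nat set \<Rightarrow> nat set" (infixr \<open>\<oplus>\<close> 65) where
  "X \<oplus> Y = (\<lambda>n. 2 * n) ` X \<union> (\<lambda>n. 2 * n + 1) ` Y"

text \<open>A function enters an oracle through its graph.\<close>

definition graph_of :: "(nat \<Rightarrow> nat) \<Rightarrow> nat set" where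
  "graph_of f = range (\<lambda>n. prod_encode (n, f n))"

text \<open>Finite sets are represented by their canonical indices \<^const>\<open>set_encode\<close>.\<close>

definition enumeration_operator :: "(nat set \<times> nat) set \<Rightarrow> bool" where
  "enumeration_operator \<Psi> \<longleftrightarrow>
     (\<forall>(\<alpha>, b) \<in> \<Psi>. finite \<alpha>) \<and>
     ce_set ((\<lambda>(\<alpha>, b). prod_encode (set_encode \<alpha>, b)) ` \<Psi>)"

definition enum_apply :: "(nat set \<times> nat) set \<Rightarrow> nat set \<Rightarrow> nat set" where
  "enum_apply \<Psi> X = {b. \<exists>\<alpha>. \<alpha> \<subseteq> X \<and> (\<alpha>, b) \<in> \<Psi>}"

record language =
  symbols :: "nat set"
  arity :: "nat \<Rightarrow> nat"

definition computable_language :: "language \<Rightarrow> bool" where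
  "computable_language L \<longleftrightarrow>
     computable_set (symbols L) \<and>
     (\<exists>p. \<forall>R \<in> symbols L. run p {} R = Some (arity L R))"

record 'a relstruct =
  universe :: "'a set"
  rel :: "nat \<Rightarrow> 'a list set"

text \<open>Tuples over \<open>U\<close> to which the symbol \<open>R\<close> can be applied.\<close>

definition tuples :: "language \<Rightarrow> 'a set \<Rightarrow> nat \<Rightarrow> 'a list set" where
  "tuples L U R = {xs. length xs = arity L R \<and> set xs \<subseteq> U}"

text \<open>The interpretation is required to be empty outside the language, so that a structure is
  determined by its universe and its atomic diagram.\<close>

definition countable_structure :: "language \<Rightarrow> 'a relstruct \<Rightarrow> bool" where
  "countable_structure L S \<longleftrightarrow>
     countable (universe S) \<and>
     (\<forall>R \<in> symbols L. rel S R \<subseteq> tuples L (universe S) R) \<and>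
     (\<forall>R. R \<notin> symbols L \<longrightarrow> rel S R = {})"

definition isomorphism ::
  "language \<Rightarrow> 'a relstruct \<Rightarrow> 'b relstruct \<Rightarrow> ('a \<Rightarrow> 'b) \<Rightarrow> bool" where
  "isomorphism L S T f \<longleftrightarrow>
     bij_betw f (universe S) (universe T) \<and>
     (\<forall>R \<in> symbols L. \<forall>xs \<in> tuples L (universe S) R. xs \<in> rel S R \<longleftrightarrow> map f xs \<in> rel T R)"

datatype 'a atom = Equality 'a 'a | Relation nat "'a list"

datatype 'a literal = Pos "'a atom" | Neg "'a atom"

definition atomic_sentences :: "language \<Rightarrow> 'a set \<Rightarrow> 'a atom set" where
  "atomic_sentences L U =
     {Equality a b | a b. a \<in> U \<and> b \<in> U} \<union>
     {Relation R xs | R xs. R \<in> symbols L \<and> xs \<in> tuples L U R}"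

primrec true_atom :: "'a relstruct \<Rightarrow> 'a atom \<Rightarrow> bool" where
  "true_atom S (Equality a b) \<longleftrightarrow> a = b"
| "true_atom S (Relation R xs) \<longleftrightarrow> xs \<in> rel S R"

primrec atom_code :: "nat atom \<Rightarrow> nat" where
  "atom_code (Equality a b) = sum_encode (Inl (prod_encode (a, b)))"
| "atom_code (Relation R xs) = sum_encode (Inr (prod_encode (R, list_encode xs)))"

primrec godel :: "nat literal \<Rightarrow> nat" where
  "godel (Pos \<phi>) = sum_encode (Inl (atom_code \<phi>))"
| "godel (Neg \<phi>) = sum_encode (Inr (atom_code \<phi>))"

text \<open>Equality counts as an atomic sentence, so besides \<open>b = b\<close> the diagram contains
  \<open>\<not> a = b\<close> for distinct \<open>a\<close>, \<open>b\<close>.\<close>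

definition diagram :: "language \<Rightarrow> nat relstruct \<Rightarrow> nat set" where
  "diagram L S =
     godel ` ({Pos \<phi> | \<phi>. \<phi> \<in> atomic_sentences L (universe S) \<and> true_atom S \<phi>} \<union>
              {Neg \<phi> | \<phi>. \<phi> \<in> atomic_sentences L (universe S) \<and> \<not> true_atom S \<phi>})"

text \<open>
  A category of structures is given by its language and its set of objects, all of them with
  universe \<open>\<omega>\<close>; its arrows \<open>f : C \<rightarrow> D\<close> are all isomorphisms, represented by the triples
  \<open>C, D, f\<close>.
\<close>

definition Iso :: "language \<Rightarrow> 'a relstruct \<Rightarrow> nat relstruct set" where
  "Iso L S = {C. countable_structure L C \<and> universe C = UNIV \<and> (\<exists>f. isomorphism L S C f)}"

record struct_functor =
  on_obj :: "nat relstruct \<Rightarrow> nat relstruct"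
  on_arr :: "nat relstruct \<Rightarrow> nat relstruct \<Rightarrow> (nat \<Rightarrow> nat) \<Rightarrow> (nat \<Rightarrow> nat)"

definition is_functor ::
  "language \<Rightarrow> nat relstruct set \<Rightarrow> language \<Rightarrow> nat relstruct set \<Rightarrow> struct_functor \<Rightarrow> bool" where
  "is_functor L \<CC> K \<DD> F \<longleftrightarrow>
     (\<forall>C \<in> \<CC>. on_obj F C \<in> \<DD>) \<and>
     (\<forall>C \<in> \<CC>. \<forall>D \<in> \<CC>. \<forall>f. isomorphism L C D f \<longrightarrow>
        isomorphism K (on_obj F C) (on_obj F D) (on_arr F C D f)) \<and>
     (\<forall>C \<in> \<CC>. on_arr F C C id = id) \<and>
     (\<forall>C \<in> \<CC>. \<forall>D \<in> \<CC>. \<forall>E \<in> \<CC>. \<forall>f g. isomorphism L C D f \<longrightarrow> isomorphism L D E g \<longrightarrow>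
        on_arr F C E (g \<circ> f) = on_arr F D E g \<circ> on_arr F C D f)"

definition id_functor :: struct_functor where
  "id_functor = \<lparr>on_obj = (\<lambda>C. C), on_arr = (\<lambda>C D f. f)\<rparr>"

definition comp_functor :: "struct_functor \<Rightarrow> struct_functor \<Rightarrow> struct_functor" where
  "comp_functor G F =
     \<lparr>on_obj = (\<lambda>C. on_obj G (on_obj F C)),
      on_arr = (\<lambda>C D f. on_arr G (on_obj F C) (on_obj F D) (on_arr F C D f))\<rparr>"

definition computes_arrows ::
  "language \<Rightarrow> nat relstruct set \<Rightarrow> struct_functor \<Rightarrow> prog \<Rightarrow> bool" where
  "computes_arrows L \<CC> F \<Phi> \<longleftrightarrow>
     (\<forall>C \<in> \<CC>. \<forall>D \<in> \<CC>. \<forall>f. isomorphism L C D f \<longrightarrow>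
        computes_fun \<Phi> (diagram L C \<oplus> graph_of f \<oplus> diagram L D) (on_arr F C D f))"

definition enumerable_functor ::
  "language \<Rightarrow> nat relstruct set \<Rightarrow> language \<Rightarrow> nat relstruct set \<Rightarrow> struct_functor \<Rightarrow> bool" where
  "enumerable_functor L \<CC> K \<DD> F \<longleftrightarrow>
     is_functor L \<CC> K \<DD> F \<and>
     (\<exists>\<Psi>. enumeration_operator \<Psi> \<and>
        (\<forall>C \<in> \<CC>. enum_apply \<Psi> (diagram L C) = diagram K (on_obj F C))) \<and>
     (\<exists>\<Phi>. computes_arrows L \<CC> F \<Phi>)"

definition computable_functor ::
  "language \<Rightarrow> nat relstruct set \<Rightarrow> language \<Rightarrow> nat relstruct set \<Rightarrow> struct_functor \<Rightarrow> bool" where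
  "computable_functor L \<CC> K \<DD> F \<longleftrightarrow>
     is_functor L \<CC> K \<DD> F \<and>
     (\<exists>\<Phi>. \<forall>C \<in> \<CC>. computes_set \<Phi> (diagram L C) (diagram K (on_obj F C))) \<and>
     (\<exists>\<Phi>. computes_arrows L \<CC> F \<Phi>)"

text \<open>\<open>F\<close> and \<open>G\<close> are functors \<open>\<CC> \<rightarrow> \<DD>\<close>, with \<open>L\<close> and \<open>K\<close> the languages of \<open>\<CC>\<close> and \<open>\<DD>\<close>.\<close>

definition effective_isomorphism ::
  "language \<Rightarrow> nat relstruct set \<Rightarrow> language \<Rightarrow> struct_functor \<Rightarrow> struct_functor \<Rightarrow> prog \<Rightarrow> bool"
where
  "effective_isomorphism L \<CC> K F G \<Lambda> \<longleftrightarrow>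
     (\<forall>C \<in> \<CC>. is_total \<Lambda> (diagram L C) \<and>
        isomorphism K (on_obj F C) (on_obj G C) (fun_of \<Lambda> (diagram L C))) \<and>
     (\<forall>C \<in> \<CC>. \<forall>D \<in> \<CC>. \<forall>h. isomorphism L C D h \<longrightarrow>
        fun_of \<Lambda> (diagram L D) \<circ> on_arr F C D h = on_arr G C D h \<circ> fun_of \<Lambda> (diagram L C))"

definition pseudo_inverses ::
  "language \<Rightarrow> nat relstruct set \<Rightarrow> language \<Rightarrow> nat relstruct set \<Rightarrow>
     struct_functor \<Rightarrow> struct_functor \<Rightarrow> bool" where
  "pseudo_inverses L \<CC> K \<DD> F G \<longleftrightarrow>
     (\<exists>\<Lambda> M.
        effective_isomorphism L \<CC> L id_functor (comp_functor G F) \<Lambda> \<and>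
        effective_isomorphism K \<DD> K id_functor (comp_functor F G) M \<and>
        (\<forall>C \<in> \<CC>. fun_of M (diagram K (on_obj F C)) =
           on_arr F C (on_obj G (on_obj F C)) (fun_of \<Lambda> (diagram L C))) \<and>
        (\<forall>D \<in> \<DD>. fun_of \<Lambda> (diagram L (on_obj G D)) =
           on_arr G D (on_obj F (on_obj G D)) (fun_of M (diagram K D))))"

definition enumerably_bitransformable ::
  "language \<Rightarrow> 'a relstruct \<Rightarrow> language \<Rightarrow> 'b relstruct \<Rightarrow> bool" where
  "enumerably_bitransformable L A K B \<longleftrightarrow>
     (\<exists>F G. enumerable_functor L (Iso L A) K (Iso K B) F \<and>
            enumerable_functor K (Iso K B) L (Iso L A) G \<and>
            pseudo_inverses L (Iso L A) K (Iso K B) F G)"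

definition computably_bitransformable ::
  "language \<Rightarrow> 'a relstruct \<Rightarrow> language \<Rightarrow> 'b relstruct \<Rightarrow> bool" where
  "computably_bitransformable L A K B \<longleftrightarrow>
     (\<exists>F G. computable_functor L (Iso L A) K (Iso K B) F \<and>
            computable_functor K (Iso K B) L (Iso L A) G \<and>
            pseudo_inverses L (Iso L A) K (Iso K B) F G)"

end

theory Submission
  imports Defs Complex_Main
begin

text \<open>
  The functors themselves need not be changed.  Whether a number is a literal of the target language
  over \<open>\<omega>\<close> is decidable, and of a literal and its negation exactly one lies in the diagram of
  \<open>F(C)\<close>.  So an enumeration of that diagram from \<open>C\<close> decides it: enumerate until the given
  literal or its negation appears.
\<close>

section \<open>Total recursive functionals\<close>

text \<open>One code, halting on every oracle, must work uniformly. This makes the class closed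
  under composition and primitive recursion, so later programs arise from introduction
  rules.\<close>

definition total_recursive :: "(nat set \<Rightarrow> nat \<Rightarrow> nat) \<Rightarrow> bool" where
  "total_recursive f \<longleftrightarrow> (\<exists>p. \<forall>X n. run p X n = Some (f X n))"

abbreviation decidable_rel :: "(nat set \<Rightarrow> nat \<Rightarrow> bool) \<Rightarrow> bool" where
  "decidable_rel P \<equiv> total_recursive (\<lambda>X n. of_bool (P X n))"

lemma total_recursiveI: "(\<And>X n. run p X n = Some (f X n)) \<Longrightarrow> total_recursive f"
  unfolding total_recursive_def by blast

lemma total_recursiveD: "total_recursive f \<Longrightarrow> \<exists>p. \<forall>X n. run p X n = Some (f X n)"
  unfolding total_recursive_def .

lemma total_recursive_pairD:
  assumes "total_recursive (\<lambda>X k. f X (fst (prod_decode k)) (snd (prod_decode k)))"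
  shows "\<exists>p. \<forall>X a b. run p X (prod_encode (a, b)) = Some (f X a b)"
proof -
  from total_recursiveD[OF assms] obtain p
    where "\<forall>X k. run p X k = Some (f X (fst (prod_decode k)) (snd (prod_decode k)))" ..
  then show ?thesis by (intro exI[of _ p]) simp
qed

lemma total_recursive_comp:
  assumes "total_recursive f" "total_recursive g"
  shows "total_recursive (\<lambda>X n. f X (g X n))"
proof -
  from assms[THEN total_recursiveD] obtain p q
    where "\<And>X n. run p X n = Some (f X n)" "\<And>X n. run q X n = Some (g X n)"
    by blast
  then show ?thesis by (intro total_recursiveI[of "PComp p q"]) simp
qed

lemma total_recursive_pair:
  assumes "total_recursive f" "total_recursive g"
  shows "total_recursive (\<lambda>X n. prod_encode (f X n, g X n))"
proof -
  from assms[THEN total_recursiveD] obtain p q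
    where "\<And>X n. run p X n = Some (f X n)" "\<And>X n. run q X n = Some (g X n)"
    by blast
  then show ?thesis by (intro total_recursiveI[of "PPair p q"]) simp
qed

lemma total_recursive_id: "total_recursive (\<lambda>X n. n)"
  by (rule total_recursiveI[of "PPair PFst PSnd"]) simp

lemma total_recursive_Suc: "total_recursive f \<Longrightarrow> total_recursive (\<lambda>X n. Suc (f X n))"
  by (rule total_recursive_comp[of "\<lambda>X. Suc"]) (auto intro: total_recursiveI[of PSucc])

lemma total_recursive_fst:
  "total_recursive f \<Longrightarrow> total_recursive (\<lambda>X n. fst (prod_decode (f X n)))"
  by (rule total_recursive_comp[of "\<lambda>X n. fst (prod_decode n)"]) (auto intro: total_recursiveI[of PFst])

lemma total_recursive_snd:
  "total_recursive f \<Longrightarrow> total_recursive (\<lambda>X n. snd (prod_decode (f X n)))"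
  by (rule total_recursive_comp[of "\<lambda>X n. snd (prod_decode n)"]) (auto intro: total_recursiveI[of PSnd])

lemma decidable_oracle: "total_recursive f \<Longrightarrow> decidable_rel (\<lambda>X n. f X n \<in> X)"
  by (rule total_recursive_comp[of "\<lambda>X n. of_bool (n \<in> X)"]) (auto intro: total_recursiveI[of POracle])

lemma total_recursive_const: "total_recursive (\<lambda>X n. c)"
proof (induction c)
  case 0
  show ?case by (rule total_recursiveI[of PZero]) simp
next
  case (Suc c)
  then show ?case by (rule total_recursive_Suc)
qed

text \<open>Parameter, counter and previous value reach \<open>g\<close> as nested pairs, the format
  in which \<open>PRec\<close> calls its second code.\<close>

lemma total_recursive_rec_nat:
  assumes f: "total_recursive f"
    and g: "total_recursive (\<lambda>X k. g X (fst (prod_decode k))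
      (fst (prod_decode (snd (prod_decode k)))) (snd (prod_decode (snd (prod_decode k)))))"
    and m: "total_recursive m"
  shows "total_recursive (\<lambda>X n. rec_nat (f X n) (g X n) (m X n))"
proof -
  from total_recursiveD[OF f] obtain p where p: "\<And>X n. run p X n = Some (f X n)"
    by blast
  from total_recursive_pairD[OF g]
  obtain q where "\<forall>X a b. run q X (prod_encode (a, b)) =
      Some (g X a (fst (prod_decode b)) (snd (prod_decode b)))" ..
  then have q: "run q X (prod_encode (a, prod_encode (i, r))) = Some (g X a i r)" for X a i r
    by simp
  have "run (PRec p q) X (prod_encode (n, k)) = Some (rec_nat (f X n) (g X n) k)" for X n k
    by (induction k) (simp_all add: p q)
  then have "total_recursive (\<lambda>X k. rec_nat (f X (fst (prod_decode k))) (g X (fst (prod_decode k)))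
      (snd (prod_decode k)))"
    by (intro total_recursiveI[of "PRec p q"]) (metis prod_decode_inverse prod.collapse)
  \<comment> \<open>\<open>PRec\<close> recurses on the second component, so the input
    \<open>n\<close> is first paired with \<open>m X n\<close>.\<close>
  from total_recursive_comp[OF this total_recursive_pair[OF total_recursive_id m]]
  show ?thesis by simp
qed

lemma total_recursive_if:
  assumes "decidable_rel P" "total_recursive f" "total_recursive g"
  shows "total_recursive (\<lambda>X n. if P X n then f X n else g X n)"
proof -
  \<comment> \<open>A recursion of length 0 returns \<open>g\<close>, one of length 1 returns
    \<open>f\<close>.\<close>
  have "total_recursive (\<lambda>X n. rec_nat (g X n) (\<lambda>_ _. f X n) (of_bool (P X n)))"
    by (intro total_recursive_rec_nat assms total_recursive_fst total_recursive_id
        total_recursive_comp[OF assms(2)])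
  then show ?thesis by (rule back_subst[where P = total_recursive]) (auto simp: fun_eq_iff)
qed

section \<open>Arithmetic, Boolean combinations and equality\<close>

lemma total_recursive_add:
  assumes "total_recursive f" "total_recursive g"
  shows "total_recursive (\<lambda>X n. f X n + g X n)"
proof -
  have "rec_nat a (\<lambda>_. Suc) b = a + b" for a b by (induction b) auto
  moreover have "total_recursive (\<lambda>X n. rec_nat (f X n) (\<lambda>_. Suc) (g X n))"
    by (intro total_recursive_rec_nat assms total_recursive_Suc total_recursive_snd total_recursive_id)
  ultimately show ?thesis by simp
qed

lemma total_recursive_diff:
  assumes "total_recursive f" "total_recursive g"
  shows "total_recursive (\<lambda>X n. f X n - g X n)"
proof -
  \<comment> \<open>The counter at the last step is the predecessor; iterating the predecessor gives
    truncated subtraction.\<close>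
  have "rec_nat 0 (\<lambda>i _. i) a = a - 1" for a by (cases a) auto
  moreover have "total_recursive (\<lambda>X n. rec_nat 0 (\<lambda>i _. i) n)"
    by (intro total_recursive_rec_nat total_recursive_const total_recursive_fst total_recursive_snd
        total_recursive_id)
  ultimately have pred: "total_recursive (\<lambda>X n. n - 1)" by simp
  have "rec_nat a (\<lambda>_ r. r - 1) b = a - b" for a b by (induction b) auto
  moreover have "total_recursive (\<lambda>X n. rec_nat (f X n) (\<lambda>_ r. r - 1) (g X n))"
    by (intro total_recursive_rec_nat assms total_recursive_snd total_recursive_id
        total_recursive_comp[OF pred])
  ultimately show ?thesis by simp
qed

lemma decidable_eq_0:
  assumes "total_recursive f"
  shows "decidable_rel (\<lambda>X n. f X n = 0)"
proof -
  have "total_recursive (\<lambda>X n. 1 - f X n)"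
    by (intro total_recursive_diff total_recursive_const assms)
  then show ?thesis by (rule back_subst[where P = total_recursive]) (auto simp: fun_eq_iff)
qed

lemma decidable_not:
  assumes "decidable_rel P"
  shows "decidable_rel (\<lambda>X n. \<not> P X n)"
  using decidable_eq_0[OF assms] by simp

lemma decidable_conj:
  assumes "decidable_rel P" "decidable_rel Q"
  shows "decidable_rel (\<lambda>X n. P X n \<and> Q X n)"
proof -
  have "total_recursive (\<lambda>X n. if P X n then of_bool (Q X n) else 0)"
    by (intro total_recursive_if total_recursive_const assms)
  then show ?thesis by (rule back_subst[where P = total_recursive]) (auto simp: fun_eq_iff)
qed

lemma decidable_disj:
  assumes "decidable_rel P" "decidable_rel Q"
  shows "decidable_rel (\<lambda>X n. P X n \<or> Q X n)"
  using decidable_not[OF decidable_conj[OF decidable_not[OF assms(1)] decidable_not[OF assms(2)]]]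
  by simp

lemma decidable_eq:
  assumes "total_recursive f" "total_recursive g"
  shows "decidable_rel (\<lambda>X n. f X n = g X n)"
proof -
  have "decidable_rel (\<lambda>X n. f X n - g X n = 0 \<and> g X n - f X n = 0)"
    by (intro decidable_conj decidable_eq_0 total_recursive_diff assms)
  then show ?thesis
    by (rule back_subst[where P = total_recursive]) (auto simp: fun_eq_iff)
qed

lemmas total_recursive_intros =
  total_recursive_id total_recursive_const total_recursive_Suc total_recursive_pair
  total_recursive_fst total_recursive_snd total_recursive_if total_recursive_add
  total_recursive_diff decidable_oracle decidable_eq decidable_not decidable_conj decidable_disj

section \<open>Bits, canonically coded finite sets and bounded quantifiers\<close>

lemma decidable_even:
  assumes "total_recursive f"
  shows "decidable_rel (\<lambda>X n. even (f X n))"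
proof -
  have "rec_nat 1 (\<lambda>_ r. 1 - r) a = (of_bool (even a) :: nat)" for a by (induction a) auto
  moreover have "total_recursive (\<lambda>X n. rec_nat 1 (\<lambda>_ r. 1 - r) (f X n))"
    by (intro total_recursive_rec_nat total_recursive_intros assms)
  ultimately show ?thesis by simp
qed

lemma total_recursive_div_2:
  assumes "total_recursive f"
  shows "total_recursive (\<lambda>X n. f X n div 2)"
proof -
  have "rec_nat 0 (\<lambda>i r. if even i then r else Suc r) a = a div 2" for a
    by (induction a) auto
  moreover have "total_recursive (\<lambda>X n. rec_nat 0 (\<lambda>i r. if even i then r else Suc r) (f X n))"
    by (intro total_recursive_rec_nat total_recursive_intros decidable_even assms)
  ultimately show ?thesis by simp
qed

text \<open>Canonical indices are binary: halve the index as often as the element says and test the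
  last bit.\<close>

lemma decidable_mem_set_decode:
  assumes "total_recursive f" "total_recursive g"
  shows "decidable_rel (\<lambda>X n. f X n \<in> set_decode (g X n))"
proof -
  have "rec_nat b (\<lambda>_ r. r div 2) a = b div 2 ^ a" for a b :: nat
    by (induction a) (auto simp: div_mult2_eq mult.commute[of 2])
  moreover have "decidable_rel (\<lambda>X n. \<not> even (rec_nat (g X n) (\<lambda>_ r. r div 2) (f X n)))"
    by (intro total_recursive_rec_nat total_recursive_intros decidable_even total_recursive_div_2
        assms)
  ultimately show ?thesis by (simp add: set_decode_def)
qed

lemma decidable_all_less:
  assumes P: "decidable_rel (\<lambda>X k. P X (fst (prod_decode k)) (snd (prod_decode k)))"
    and m: "total_recursive m"
  shows "decidable_rel (\<lambda>X n. \<forall>i < m X n. P X n i)"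
proof -
  have "rec_nat 1 (\<lambda>i r. if P X n i then r else 0) a = (of_bool (\<forall>i<a. P X n i) :: nat)" for X n a
    by (induction a) (auto simp: less_Suc_eq)
  moreover have "total_recursive (\<lambda>X n. rec_nat 1 (\<lambda>i r. if P X n i then r else 0) (m X n))"
  proof -
    have "decidable_rel (\<lambda>X k. P X (fst (prod_decode k)) (fst (prod_decode (snd (prod_decode k)))))"
      using total_recursive_comp[OF P, of "\<lambda>X k. prod_encode (fst (prod_decode k),
        fst (prod_decode (snd (prod_decode k))))"]
      by (simp add: total_recursive_intros)
    then show ?thesis by (intro total_recursive_rec_nat total_recursive_intros m)
  qed
  ultimately show ?thesis by simp
qed

text \<open>An element \<open>i\<close> contributes \<open>2 ^ i\<close> to the index and so lies
  below it; inclusion in the oracle is therefore a bounded quantifier.\<close>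

lemma decidable_set_decode_subset_oracle:
  assumes "total_recursive f"
  shows "decidable_rel (\<lambda>X n. set_decode (f X n) \<subseteq> X)"
proof -
  have "i < a" if "i \<in> set_decode a" for i a
  proof -
    have "2 ^ i \<le> a"
      using that by (auto simp: set_decode_def intro: ccontr)
    then show ?thesis using less_exp[of i] by (rule order.strict_trans2[rotated])
  qed
  then have "set_decode a \<subseteq> X \<longleftrightarrow> (\<forall>i<a. \<not> i \<in> set_decode a \<or> i \<in> X)" for a X
    by blast
  moreover have "decidable_rel (\<lambda>X n. \<forall>i < f X n. \<not> i \<in> set_decode (f X n) \<or> i \<in> X)"
    by (intro decidable_all_less total_recursive_intros decidable_mem_set_decode assms
        total_recursive_comp[OF assms])
  ultimately show ?thesis by simp
qed

text \<open>Each query is replaced by the answer of the empty oracle. Programs specified only for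
  \<open>{}\<close>, such as those of a computable language, can then be run relative to a
  diagram.\<close>

primrec clear_oracle :: "prog \<Rightarrow> prog" where
  "clear_oracle PZero = PZero"
| "clear_oracle PSucc = PSucc"
| "clear_oracle PFst = PFst"
| "clear_oracle PSnd = PSnd"
| "clear_oracle POracle = PZero"
| "clear_oracle (PPair p q) = PPair (clear_oracle p) (clear_oracle q)"
| "clear_oracle (PComp p q) = PComp (clear_oracle p) (clear_oracle q)"
| "clear_oracle (PRec p q) = PRec (clear_oracle p) (clear_oracle q)"
| "clear_oracle (PMu p) = PMu (clear_oracle p)"

lemma run_clear_oracle: "run (clear_oracle p) X = run p {}"
  by (induction p) (rule ext, simp)+

text \<open>\<open>p\<close> may diverge where \<open>P\<close> fails, so it must not be run there.\<close>

lemma total_recursive_guarded: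
  assumes P: "decidable_rel P"
    and p: "\<And>X n. P X n \<Longrightarrow> run p X n = Some (f X n)"
  shows "total_recursive (\<lambda>X n. if P X n then f X n else 0)"
proof -
  from total_recursiveD[OF P] obtain q where q: "\<And>X n. run q X n = Some (of_bool (P X n))"
    by blast
  \<comment> \<open>The recursion has length \<open>of_bool (P X n)\<close>: at length 0 it yields 0
    without calling \<open>p\<close>, at length 1 it calls \<open>p\<close> once, on
    \<open>n\<close> recovered by \<open>PFst\<close>.\<close>
  show ?thesis
    by (rule total_recursiveI[of "PComp (PRec PZero (PComp p PFst)) (PPair (PPair PFst PSnd) q)"])
      (simp add: q p)
qed

section \<open>Step-bounded evaluation\<close>

text \<open>The first \<open>k < s\<close> with \<open>e k \<le> 1\<close> decides the search: the value is \<open>Suc (Suc k)\<close> if \<open>e k = 1\<close>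
  and \<open>1\<close> if \<open>e k = 0\<close>; it is \<open>0\<close> if there is no such \<open>k\<close>.\<close>

definition bounded_search :: "(nat \<Rightarrow> nat) \<Rightarrow> nat \<Rightarrow> nat" where
  "bounded_search e s = rec_nat 0 (\<lambda>i r. if r = 0 then if e i = 0 then 1
     else if e i = 1 then Suc (Suc i) else 0 else r) s"

lemma bounded_search_eq_0: "bounded_search e s = 0 \<Longrightarrow> k < s \<Longrightarrow> 1 < e k"
  by (induction s) (auto simp: bounded_search_def less_Suc_eq split: if_splits)

text \<open>A nonzero state never changes again, so the state was still 0 when \<open>k\<close> was
  recorded, and \<open>bounded_search_eq_0\<close> excludes an earlier decision.\<close>

lemma bounded_search_sound:
  "bounded_search e s = Suc (Suc k) \<Longrightarrow> e k = 1 \<and> (\<forall>i<k. 1 < e i)"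
proof (induction s)
  case (Suc s)
  then show ?case
    using bounded_search_eq_0[of e s]
    by (auto simp: bounded_search_def split: if_splits)
qed (simp add: bounded_search_def)

lemma bounded_search_complete:
  assumes "e k = 1" "\<And>i. i < k \<Longrightarrow> 1 < e i" "k < s"
  shows "bounded_search e s = Suc (Suc k)"
proof -
  have "bounded_search e k = 0"
  proof -
    have "i \<le> k \<Longrightarrow> bounded_search e i = 0" for i
      by (induction i) (use assms(2) in \<open>force simp: bounded_search_def Suc_le_eq\<close>)+
    then show ?thesis by simp
  qed
  from \<open>k < s\<close> show ?thesis
  proof (induction s)
    case (Suc s)
    then show ?case
      using assms(1) \<open>bounded_search e k = 0\<close>
      by (cases "k = s") (auto simp: bounded_search_def)
  qed simp
qed

text \<open>Evaluation with the empty oracle where every unbounded search is cut off at \<open>s\<close>; the value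
  \<open>0\<close> means divergence and \<open>Suc y\<close> means the result \<open>y\<close>.\<close>

primrec eval_upto :: "prog \<Rightarrow> nat \<Rightarrow> nat \<Rightarrow> nat" where
  "eval_upto PZero s n = 1"
| "eval_upto PSucc s n = Suc (Suc n)"
| "eval_upto PFst s n = Suc (fst (prod_decode n))"
| "eval_upto PSnd s n = Suc (snd (prod_decode n))"
| "eval_upto POracle s n = 1"
| "eval_upto (PPair p q) s n =
     (if eval_upto p s n = 0 \<or> eval_upto q s n = 0 then 0
      else Suc (prod_encode (eval_upto p s n - 1, eval_upto q s n - 1)))"
| "eval_upto (PComp p q) s n =
     (if eval_upto q s n = 0 then 0 else eval_upto p s (eval_upto q s n - 1))"
| "eval_upto (PRec p q) s n =
     rec_nat (eval_upto p s (fst (prod_decode n)))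
       (\<lambda>i r. if r = 0 then 0
          else eval_upto q s (prod_encode (fst (prod_decode n), prod_encode (i, r - 1))))
       (snd (prod_decode n))"
| "eval_upto (PMu p) s n = bounded_search (\<lambda>i. eval_upto p s (prod_encode (n, i))) s - 1"

text \<open>For a fixed \<open>p\<close> the clauses use only case distinctions and recursions of
  known length, so induction on \<open>p\<close> suffices. Generalising \<open>f\<close> and
  \<open>g\<close> covers the nested calls.\<close>

lemma total_recursive_eval_upto:
  "total_recursive f \<Longrightarrow> total_recursive g \<Longrightarrow> total_recursive (\<lambda>X n. eval_upto p (f X n) (g X n))"
proof (induction p arbitrary: f g)
  case (PPair p q)
  show ?case unfolding eval_upto.simps by (intro total_recursive_intros PPair)
next
  case (PComp p q)
  show ?case unfolding eval_upto.simps by (intro total_recursive_intros PComp)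
next
  case (PRec p q)
  show ?case unfolding eval_upto.simps
    by (intro total_recursive_rec_nat total_recursive_intros PRec
        total_recursive_comp[OF PRec.prems(1)] total_recursive_comp[OF PRec.prems(2)])
next
  case (PMu p)
  show ?case unfolding eval_upto.simps bounded_search_def
    by (intro total_recursive_rec_nat total_recursive_intros PMu
        total_recursive_comp[OF PMu.prems(1)] total_recursive_comp[OF PMu.prems(2)])
qed (simp_all only: eval_upto.simps; intro total_recursive_intros; assumption)+

lemma eval_upto_PRec_Suc:
  "eval_upto (PRec p q) s (prod_encode (a, Suc m)) =
     (case eval_upto (PRec p q) s (prod_encode (a, m)) of 0 \<Rightarrow> 0
      | Suc z \<Rightarrow> eval_upto q s (prod_encode (a, prod_encode (m, z))))"
  by (simp only: eval_upto.simps prod_encode_inverse fst_conv snd_conv nat.rec) (simp split: nat.split)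

text \<open>Cutting off a search can only cause divergence, never a wrong value: the search accepts
  \<open>k\<close> only after all smaller arguments have produced positive results.\<close>

lemma eval_upto_sound: "eval_upto p s n = Suc y \<Longrightarrow> run p {} n = Some y"
proof (induction p arbitrary: n y)
  case (PPair p q)
  then show ?case by (cases "eval_upto p s n"; cases "eval_upto q s n") auto
next
  case (PComp p q)
  then show ?case by (cases "eval_upto q s n") auto
next
  case (PRec p q)
  obtain a m where n: "n = prod_encode (a, m)" by (metis prod_decode_inverse surj_pair)
  from PRec.prems show ?case unfolding n
  proof (induction m arbitrary: y)
    case 0
    then show ?case by (simp add: PRec.IH)
  next
    case (Suc m)
    let ?r = "eval_upto (PRec p q) s (prod_encode (a, m))"
    from Suc.prems obtain z where "?r = Suc z"
      by (cases ?r) (simp_all only: eval_upto_PRec_Suc nat.case)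
    with Suc.prems Suc.IH[OF this] show ?case
      by (simp add: eval_upto_PRec_Suc PRec.IH del: eval_upto.simps)
  qed
next
  case (PMu p)
  let ?e = "\<lambda>i. eval_upto p s (prod_encode (n, i))"
  \<comment> \<open>Truncated \<open>- 1\<close> maps both failing outcomes 0 and 1 to 0, so a
    result \<open>Suc y\<close> comes only from a successful search.\<close>
  have "bounded_search ?e s = Suc (Suc y)" using PMu.prems by simp
  then have e: "?e y = Suc 0" "i < y \<Longrightarrow> 1 < ?e i" for i
    using bounded_search_sound[of ?e s y] by auto
  have y: "run p {} (prod_encode (n, y)) = Some 0" by (rule PMu.IH[OF e(1)])
  have less: "\<exists>k. run p {} (prod_encode (n, i)) = Some (Suc k)" if "i < y" for i
  proof -
    from less_imp_Suc_add[OF e(2)[OF that]] obtain k where "?e i = Suc (1 + k)" by (rule exE)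
    then show ?thesis by (intro exI[of _ k] PMu.IH) simp
  qed
  have "(LEAST i. run p {} (prod_encode (n, i)) = Some 0) = y"
  proof (intro Least_equality y)
    fix i assume "run p {} (prod_encode (n, i)) = Some 0"
    then show "y \<le> i" using less[of i] by (cases "i < y") auto
  qed
  then show ?case using y less by auto
qed auto

text \<open>A halting run uses finitely many subcomputations. Stating the claim for all large bounds
  lets their bounds be combined directly.\<close>

lemma eval_upto_complete:
  "run p {} n = Some y \<Longrightarrow> \<forall>\<^sub>F s in sequentially. eval_upto p s n = Suc y"
proof (induction p arbitrary: n y)
  case (PPair p q)
  from PPair.prems obtain u v where "run p {} n = Some u" "run q {} n = Some v"
    and y: "y = prod_encode (u, v)"
    by (auto simp: bind_eq_Some_conv)
  from PPair.IH(1)[OF this(1)] PPair.IH(2)[OF this(2)] show ?case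
    by eventually_elim (simp add: y)
next
  case (PComp p q)
  from PComp.prems obtain u where "run q {} n = Some u" "run p {} u = Some y"
    by (auto simp: bind_eq_Some_conv)
  from PComp.IH(2)[OF this(1)] PComp.IH(1)[OF this(2)] show ?case
    by eventually_elim simp
next
  case (PRec p q)
  obtain a m where n: "n = prod_encode (a, m)" by (metis prod_decode_inverse surj_pair)
  from PRec.prems show ?case unfolding n
  proof (induction m arbitrary: y)
    case 0
    then show ?case by (simp add: PRec.IH)
  next
    case (Suc m)
    from Suc.prems obtain z where "run (PRec p q) {} (prod_encode (a, m)) = Some z"
      and "run q {} (prod_encode (a, prod_encode (m, z))) = Some y"
      by (auto simp: bind_eq_Some_conv)
    from Suc.IH[OF this(1)] PRec.IH(2)[OF this(2)] show ?case
      by eventually_elim (simp only: eval_upto_PRec_Suc nat.case)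
  qed
next
  case (PMu p)
  from PMu.prems obtain k where k: "run p {} (prod_encode (n, k)) = Some 0"
    and less: "\<And>i. i < k \<Longrightarrow> \<exists>v. run p {} (prod_encode (n, i)) = Some (Suc v)"
    and "y = (LEAST i. run p {} (prod_encode (n, i)) = Some 0)"
    by (auto split: if_splits)
  moreover have "(LEAST i. run p {} (prod_encode (n, i)) = Some 0) = k"
    using k less by (intro Least_equality) (force simp: not_less[symmetric])+
  ultimately have "y = k" by simp
  \<comment> \<open>The finitely many arguments below \<open>k\<close> get a common bound;
    \<open>eventually_gt_at_top\<close> then puts \<open>k\<close> itself within the range of the
    search.\<close>
  have "\<forall>\<^sub>F s in sequentially. \<forall>i\<in>{..<k}. 1 < eval_upto p s (prod_encode (n, i))"
  proof (rule eventually_ball_finite; safe?)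
    fix i assume "i < k"
    with less obtain v where "run p {} (prod_encode (n, i)) = Some (Suc v)" by blast
    from PMu.IH[OF this] show "\<forall>\<^sub>F s in sequentially. 1 < eval_upto p s (prod_encode (n, i))"
      by eventually_elim simp
  qed
  with PMu.IH[OF k] eventually_gt_at_top[of k] show ?case
    by eventually_elim (simp add: bounded_search_complete \<open>y = k\<close>)
qed auto

text \<open>Normal form of halting: c.e. membership becomes a search for a stage at which a total
  recursive test succeeds.\<close>

lemma run_neq_None_iff: "run p {} n \<noteq> None \<longleftrightarrow> (\<exists>s. eval_upto p s n \<noteq> 0)"
proof
  assume "run p {} n \<noteq> None"
  then obtain y where "\<forall>\<^sub>F s in sequentially. eval_upto p s n = Suc y"
    using eval_upto_complete by blast
  then obtain s where "eval_upto p s n = Suc y"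
    unfolding eventually_sequentially by blast
  then show "\<exists>s. eval_upto p s n \<noteq> 0" by (intro exI[of _ s]) simp
next
  assume "\<exists>s. eval_upto p s n \<noteq> 0"
  then show "run p {} n \<noteq> None" by (metis eval_upto_sound not0_implies_Suc option.discI)
qed

section \<open>Deciding a diagram from an enumeration\<close>

text \<open>A witness \<open>t\<close> pairs the index of a finite set with a stage. The test
  queries the oracle for the inclusion, and evaluates the enumeration of \<Psi> with the empty
  oracle.\<close>

lemma enum_apply_witness:
  assumes "enumeration_operator \<Psi>"
  shows "\<exists>W. decidable_rel (\<lambda>X n. W X (fst (prod_decode n)) (snd (prod_decode n))) \<and>
    (\<forall>X b. b \<in> enum_apply \<Psi> X \<longleftrightarrow> (\<exists>t. W X b t))"
proof -
  from assms have "\<forall>(\<alpha>, b) \<in> \<Psi>. finite \<alpha>"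
    unfolding enumeration_operator_def by (rule conjunct1)
  then have fin: "finite \<alpha>" if "(\<alpha>, b) \<in> \<Psi>" for \<alpha> b
    using that by blast
  from assms obtain p where
    p: "(\<lambda>(\<alpha>, b). prod_encode (set_encode \<alpha>, b)) ` \<Psi> = {n. run p {} n \<noteq> None}"
    unfolding enumeration_operator_def ce_set_def by (elim conjE exE)
  have mem: "(set_decode a, b) \<in> \<Psi> \<longleftrightarrow> (\<exists>s. eval_upto p s (prod_encode (a, b)) \<noteq> 0)" for a b
  proof -
    \<comment> \<open>Finiteness prevents collisions: \<open>set_encode\<close> sends infinite sets
      to 0, the index of the empty set.\<close>
    have "(set_decode a, b) \<in> \<Psi> \<longleftrightarrow> prod_encode (a, b) \<in> (\<lambda>(\<alpha>, b). prod_encode (set_encode \<alpha>, b)) ` \<Psi>"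
      using fin by (force simp: image_iff)
    then show ?thesis unfolding p mem_Collect_eq run_neq_None_iff .
  qed
  define W where "W X b t \<longleftrightarrow> set_decode (fst (prod_decode t)) \<subseteq> X \<and>
    \<not> eval_upto p (snd (prod_decode t)) (prod_encode (fst (prod_decode t), b)) = 0" for X b t
  show ?thesis
  proof (intro exI conjI allI)
    show "decidable_rel (\<lambda>X n. W X (fst (prod_decode n)) (snd (prod_decode n)))"
      unfolding W_def
      by (intro total_recursive_intros decidable_set_decode_subset_oracle total_recursive_eval_upto)
    have "(\<exists>t. W X b t) \<longleftrightarrow> (\<exists>a s. W X b (prod_encode (a, s)))" for X b
      by (metis prod_decode_inverse surj_pair)
    also have "\<dots> X b \<longleftrightarrow> (\<exists>a. set_decode a \<subseteq> X \<and> (set_decode a, b) \<in> \<Psi>)" for X b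
      by (simp add: W_def mem)
    also have "\<dots> X b \<longleftrightarrow> b \<in> enum_apply \<Psi> X" for X b
      unfolding enum_apply_def using fin by (auto, metis set_encode_inverse)
    finally show "b \<in> enum_apply \<Psi> X \<longleftrightarrow> (\<exists>t. W X b t)" for X b by simp
  qed
qed

text \<open>Post's theorem relative to \<open>X\<close>: the complement of \<open>Y\<close> is
  enumerable from \<open>X\<close> too, through non-literals and negations. Obtaining \<Phi> before
  \<open>X\<close> and \<open>Y\<close> gives one program for all objects.\<close>

lemma computes_set_enum_apply:
  assumes \<Psi>: "enumeration_operator \<Psi>"
    and lit: "decidable_rel (\<lambda>X. lit)"
    and neg: "total_recursive (\<lambda>X. neg)"
  obtains \<Phi> where "\<And>X Y. enum_apply \<Psi> X = Y \<Longrightarrow> (\<And>n. n \<notin> Y \<longleftrightarrow> \<not> lit n \<or> neg n \<in> Y)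
    \<Longrightarrow> computes_set \<Phi> X Y"
proof -
  from enum_apply_witness[OF \<Psi>] obtain W where
    W: "decidable_rel (\<lambda>X n. W X (fst (prod_decode n)) (snd (prod_decode n)))"
    and enum: "\<forall>X b. b \<in> enum_apply \<Psi> X \<longleftrightarrow> (\<exists>t. W X b t)"
    by (elim exE conjE)
  \<comment> \<open>\<open>t\<close> settles \<open>n\<close>: the first disjunct certifies that
    \<open>n\<close> is outside \<open>Y\<close>, the second that it is inside.\<close>
  define S where "S X n t \<longleftrightarrow> (\<not> lit n \<or> W X (neg n) t) \<or> W X n t" for X n t
  have "decidable_rel (\<lambda>X k. lit (fst (prod_decode k)))"
    by (rule total_recursive_comp[OF lit]) (intro total_recursive_intros)
  moreover have "decidable_rel (\<lambda>X k. W X (neg (fst (prod_decode k))) (snd (prod_decode k)))"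
    using total_recursive_comp[OF W, of "\<lambda>X k. prod_encode (neg (fst (prod_decode k)), snd (prod_decode k))"]
      total_recursive_comp[OF neg, of "\<lambda>X k. fst (prod_decode k)"]
    by (simp add: total_recursive_intros)
  \<comment> \<open>\<open>S\<close> is negated because \<open>PMu\<close> searches for the value
    0.\<close>
  ultimately have S: "decidable_rel (\<lambda>X k. \<not> S X (fst (prod_decode k)) (snd (prod_decode k)))"
    unfolding S_def by (intro total_recursive_intros W)
  from total_recursive_pairD[OF S] obtain q
    where q: "\<And>X n t. run q X (prod_encode (n, t)) = Some (of_bool (\<not> S X n t))"
    by blast
  from total_recursive_pairD[OF W] obtain w
    where w: "\<And>X n t. run w X (prod_encode (n, t)) = Some (of_bool (W X n t))"
    by blast
  show ?thesis
  proof (rule that)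
    fix X Y
    assume Y: "enum_apply \<Psi> X = Y" and compl: "\<And>n. n \<notin> Y \<longleftrightarrow> \<not> lit n \<or> neg n \<in> Y"
    have W_Y: "n \<in> Y \<longleftrightarrow> (\<exists>t. W X n t)" for n using enum Y by blast
    have "run (PComp w (PPair (PPair PFst PSnd) (PMu q))) X n = Some (of_bool (n \<in> Y))" for n
    proof -
      define t where "t = (LEAST t. S X n t)"
      have "\<exists>t. S X n t" unfolding S_def using compl W_Y by blast
      then have t: "S X n t" "\<And>i. i < t \<Longrightarrow> \<not> S X n i"
        unfolding t_def by (auto intro: LeastI dest: not_less_Least)
      have "run (PMu q) X n = Some t"
      proof -
        have q_S: "run q X (prod_encode (n, i)) = Some 0 \<longleftrightarrow> S X n i"
          "(\<exists>k. run q X (prod_encode (n, i)) = Some (Suc k)) \<longleftrightarrow> \<not> S X n i" for i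
          by (cases "S X n i"; simp add: q)+
        show ?thesis unfolding run.simps q_S t_def[symmetric] using t by auto
      qed
      \<comment> \<open>A negative certificate excludes every positive one, so testing
        \<open>W\<close> at the first settling \<open>t\<close> answers the question.\<close>
      moreover have "W X n t \<longleftrightarrow> n \<in> Y"
        using t(1) compl W_Y unfolding S_def by blast
      ultimately show ?thesis by (simp add: w)
    qed
    then show "computes_set (PComp w (PPair (PPair PFst PSnd) (PMu q))) X Y"
      by (simp add: computes_set_def computes_fun_def)
  qed
qed

section \<open>Codes of literals\<close>

lemma inj_atom_code: "inj atom_code"
proof (rule injI)
  show "atom_code \<phi> = atom_code \<psi> \<Longrightarrow> \<phi> = \<psi>" for \<phi> \<psi>
    by (cases \<phi>; cases \<psi>) (simp_all add: sum_encode_eq prod_encode_eq list_encode_eq)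
qed

lemma surj_atom_code: "surj atom_code"
proof (rule surjI)
  fix a
  show "atom_code (case sum_decode a of
      Inl k \<Rightarrow> Equality (fst (prod_decode k)) (snd (prod_decode k))
    | Inr k \<Rightarrow> Relation (fst (prod_decode k)) (list_decode (snd (prod_decode k)))) = a"
    by (cases "sum_decode a") (simp_all, (metis sum_decode_inverse)+)
qed

lemma inj_godel: "inj godel"
proof (rule injI)
  show "godel l = godel l' \<Longrightarrow> l = l'" for l l'
    by (cases l; cases l') (simp_all add: sum_encode_eq inj_eq[OF inj_atom_code])
qed

text \<open>Every number codes a literal, possibly with a foreign symbol or a wrong arity, so case
  distinctions on numbers become ones on literals.\<close>

lemma surj_godel: "surj godel"
proof (rule surjI)
  fix n
  show "godel (case sum_decode n of Inl a \<Rightarrow> Pos (inv atom_code a) | Inr a \<Rightarrow> Neg (inv atom_code a)) = n"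
    by (cases "sum_decode n") (simp_all add: surj_f_inv_f[OF surj_atom_code], (metis sum_decode_inverse)+)
qed

text \<open>The last bit of a code is the sign of the literal, the next one tells relations from equalities.\<close>

definition literal_codes :: "language \<Rightarrow> nat set" where
  "literal_codes L = {n. odd (n div 2) \<longrightarrow> (let k = prod_decode (n div 2 div 2) in
     fst k \<in> symbols L \<and> length (list_decode (snd k)) = arity L (fst k))}"

text \<open>Flips the last bit: \<open>sum_encode\<close> makes codes of positive literals even and
  those of negative ones odd.\<close>

definition negate_code :: "nat \<Rightarrow> nat" where
  "negate_code n = (if even n then Suc n else n - 1)"

lemma negate_code_godel:
  "negate_code (godel (Pos \<phi>)) = godel (Neg \<phi>)" "negate_code (godel (Neg \<phi>)) = godel (Pos \<phi>)"
  by (simp_all add: negate_code_def sum_encode_def)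

text \<open>Equalities have even codes and are always sentences over \<open>UNIV\<close>. For
  relations only symbol and tuple length matter, as all entries lie in \<open>UNIV\<close>.\<close>

lemma atom_code_parity:
  "(odd (atom_code \<phi>) \<longrightarrow> (let k = prod_decode (atom_code \<phi> div 2) in
     fst k \<in> symbols L \<and> length (list_decode (snd k)) = arity L (fst k)))
   \<longleftrightarrow> \<phi> \<in> atomic_sentences L UNIV"
  by (cases \<phi>) (simp_all add: sum_encode_def atomic_sentences_def tuples_def)

lemma godel_in_literal_codes:
  "godel (Pos \<phi>) \<in> literal_codes L \<longleftrightarrow> \<phi> \<in> atomic_sentences L UNIV"
  "godel (Neg \<phi>) \<in> literal_codes L \<longleftrightarrow> \<phi> \<in> atomic_sentences L UNIV"
  unfolding atom_code_parity[symmetric] literal_codes_def by (simp_all add: sum_encode_def)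

lemma godel_in_diagram:
  "godel (Pos \<phi>) \<in> diagram L S \<longleftrightarrow> \<phi> \<in> atomic_sentences L (universe S) \<and> true_atom S \<phi>"
  "godel (Neg \<phi>) \<in> diagram L S \<longleftrightarrow> \<phi> \<in> atomic_sentences L (universe S) \<and> \<not> true_atom S \<phi>"
  unfolding diagram_def inj_image_mem_iff[OF inj_godel] by auto

text \<open>Of an atomic sentence and its negation exactly one is true. Universe \<open>UNIV\<close>
  makes being a literal depend on the language alone, not on \<open>S\<close>.\<close>

lemma notin_diagram_iff:
  assumes "universe S = UNIV"
  shows "n \<notin> diagram L S \<longleftrightarrow> n \<notin> literal_codes L \<or> negate_code n \<in> diagram L S"
proof -
  obtain l where "n = godel l" using surj_godel by (metis surjD)
  then show ?thesis
    using assms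
    by (cases l) (auto simp only: negate_code_godel godel_in_literal_codes godel_in_diagram)
qed

section \<open>Decidability of the set of literal codes\<close>

definition code_tl :: "nat \<Rightarrow> nat" where
  "code_tl c = snd (prod_decode (c - 1))"

lemma code_tl_funpow: "(code_tl ^^ k) (list_encode xs) = list_encode (drop k xs)"
proof (induction k)
  case (Suc k)
  \<comment> \<open>The empty list has code 0, and truncation gives \<open>0 - 1 = 0\<close>; this
    makes \<open>code_tl\<close> fix 0, matching \<open>tl [] = []\<close>.\<close>
  have "prod_decode 0 = (0, 0)" by (simp add: prod_decode_def prod_decode_aux.simps)
  then have "code_tl (list_encode ys) = list_encode (tl ys)" for ys
    by (cases ys) (simp_all add: code_tl_def)
  then show ?case by (simp add: Suc drop_Suc tl_drop)
qed simp

text \<open>Taking \<open>k\<close> tails reaches the empty list, whose code is 0, exactly for lists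
  of length at most \<open>k\<close>.\<close>

lemma length_list_decode_le_iff:
  "length (list_decode c) \<le> k \<longleftrightarrow> rec_nat c (\<lambda>_ r. snd (prod_decode (r - 1))) k = 0"
proof -
  have "rec_nat c (\<lambda>_ r. snd (prod_decode (r - 1))) k = (code_tl ^^ k) c"
    by (induction k) (simp_all add: code_tl_def)
  also have "\<dots> = list_encode (drop k (list_decode c))"
    using code_tl_funpow[of k "list_decode c"] by simp
  finally show ?thesis
    by (metis drop_eq_Nil list_encode.simps(1) list_encode_eq)
qed

lemma decidable_length_list_decode:
  assumes "total_recursive f" "total_recursive g"
  shows "decidable_rel (\<lambda>X n. length (list_decode (f X n)) = g X n)"
proof -
  have le: "decidable_rel (\<lambda>X n. length (list_decode (f X n)) \<le> h X n)" if "total_recursive h" for h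
    unfolding length_list_decode_le_iff
    by (intro total_recursive_rec_nat total_recursive_intros assms that)
  \<comment> \<open>The case \<open>g X n = 0\<close> stands apart because \<open>0 - 1\<close>
    truncates to 0.\<close>
  have "decidable_rel (\<lambda>X n. length (list_decode (f X n)) \<le> g X n \<and>
      (g X n = 0 \<or> \<not> length (list_decode (f X n)) \<le> g X n - 1))"
    by (intro total_recursive_intros le assms)
  then show ?thesis
    by (rule back_subst[where P = total_recursive]) (auto simp: fun_eq_iff)
qed

lemma decidable_literal_codes:
  assumes "computable_language L"
  shows "decidable_rel (\<lambda>X n. n \<in> literal_codes L)"
proof -
  from assms obtain s p where s: "\<And>n. run s {} n = Some (of_bool (n \<in> symbols L))"
    and p: "\<And>R. R \<in> symbols L \<Longrightarrow> run p {} R = Some (arity L R)"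
    unfolding computable_language_def computable_set_def computes_set_def computes_fun_def by blast
  have s': "\<And>X n. run (clear_oracle s) X n = Some (of_bool (n \<in> symbols L))"
    and p': "\<And>X R. R \<in> symbols L \<Longrightarrow> run (clear_oracle p) X R = Some (arity L R)"
    by (simp_all add: run_clear_oracle s p)
  have sym: "decidable_rel (\<lambda>X n. n \<in> symbols L)" using s' by (rule total_recursiveI)
  have ar: "total_recursive (\<lambda>X n. if n \<in> symbols L then arity L n else 0)"
    using sym p' by (rule total_recursive_guarded)
  define k where "k n = prod_decode (n div 2 div 2)" for n
  have k: "total_recursive (\<lambda>X n. fst (k n))" "total_recursive (\<lambda>X n. snd (k n))"
    unfolding k_def by (intro total_recursive_intros total_recursive_div_2)+
  \<comment> \<open>The implication is written as a disjunction to fit the introduction rules. The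
    default arity 0 is harmless, since the other conjunct demands a symbol of
    \<open>L\<close>.\<close>
  have "decidable_rel (\<lambda>X n. \<not> \<not> even (n div 2) \<or> (fst (k n) \<in> symbols L \<and>
      length (list_decode (snd (k n))) = (if fst (k n) \<in> symbols L then arity L (fst (k n)) else 0)))"
    by (intro total_recursive_intros decidable_even total_recursive_div_2
        decidable_length_list_decode k total_recursive_comp[OF sym k(1)] total_recursive_comp[OF ar k(1)])
  then show ?thesis
    by (rule back_subst[where P = total_recursive])
      (auto simp: fun_eq_iff literal_codes_def k_def Let_def)
qed

lemma total_recursive_negate_code: "total_recursive (\<lambda>X n. negate_code n)"
  unfolding negate_code_def by (intro total_recursive_intros decidable_even)

section \<open>From enumerable to computable functors\<close>

lemma enumerable_functor_computable:
  assumes K: "computable_language K"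
    and univ: "\<And>D. D \<in> \<DD> \<Longrightarrow> universe D = UNIV"
    and F: "enumerable_functor L \<CC> K \<DD> F"
  shows "computable_functor L \<CC> K \<DD> F"
proof -
  from F obtain \<Psi> where \<Psi>: "enumeration_operator \<Psi>"
    and enum: "\<And>C. C \<in> \<CC> \<Longrightarrow> enum_apply \<Psi> (diagram L C) = diagram K (on_obj F C)"
    unfolding enumerable_functor_def by blast
  from computes_set_enum_apply[OF \<Psi> decidable_literal_codes[OF K] total_recursive_negate_code]
  obtain \<Phi> where \<Phi>: "\<And>X Y. enum_apply \<Psi> X = Y \<Longrightarrow>
      (\<And>n. n \<notin> Y \<longleftrightarrow> n \<notin> literal_codes K \<or> negate_code n \<in> Y) \<Longrightarrow> computes_set \<Phi> X Y"
    by blast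
  have "computes_set \<Phi> (diagram L C) (diagram K (on_obj F C))" if "C \<in> \<CC>" for C
  proof -
    have "universe (on_obj F C) = UNIV"
      using F that univ unfolding enumerable_functor_def is_functor_def by blast
    with enum[OF that] show ?thesis by (intro \<Phi> notin_diagram_iff)
  qed
  \<comment> \<open>Functoriality and the program for arrows carry over; only the object part is
    replaced.\<close>
  with F show ?thesis
    unfolding enumerable_functor_def computable_functor_def by blast
qed

theorem theorem3:
  fixes L K :: language
    and A :: "'a relstruct"
    and B :: "'b relstruct"
  assumes "computable_language L"
    and "computable_language K"
    and "countable_structure L A"
    and "countable_structure K B"
    and "enumerably_bitransformable L A K B"
  shows "computably_bitransformable L A K B"
proof -
  have "universe C = UNIV" if "C \<in> Iso M S" for C M and S :: "'c relstruct"
    using that by (simp add: Iso_def)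
  \<comment> \<open>The same two functors serve, so their pseudo-inverse property is kept; each one
    needs computability of its target language.\<close>
  then show ?thesis
    using assms(5) enumerable_functor_computable[OF assms(1)] enumerable_functor_computable[OF assms(2)]
    unfolding enumerably_bitransformable_def computably_bitransformable_def by metis
qed

end
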